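(* Let two reciprocal two-port elements have scattering matrices $\mathbf{S}_n = \begin{bmatrix} A_n & B_n \\ B_n & D_n \end{bmatrix}$, $n=1,2$, and let their inner ports be connected through an ideal gyrator with scattering matrix $\mathbf{S}_{\mathrm{gyra}} = \begin{bmatrix} 0 & -1 \\ 1 & 0 \end{bmatrix}$. Then the scattering matrix $\mathbf{\Phi}$ of the resulting two-element group is non-symmetric and is given by $$\mathbf{\Phi} = \begin{bmatrix} A_1 - B_1^2 D_2/\Delta & -B_1B_2/\Delta \\ B_1B_2/\Delta & A_2 - B_2^2 D_1/\Delta \end{bmatrix},$$ where $\Delta = 1 + D_1D_2$.
   Context: Each element $n$ is a two-port with an outer port (interacting with free space) and an inner port (connected to the gyrator). It is characterized by a symmetric (reciprocal) $2\times 2$ impedance matrix $\mathbf{Z}_n$, and its scattering matrix is $\mathbf{S}_n = (\mathbf{Z}_n - Z_0\mathbf{I})(\mathbf{Z}_n+Z_0\mathbf{I})^{-1}$, where $Z_0$ is the free-space impedance; it is written $\mathbf{S}_n = \begin{bmatrix} A_n & B_n \\ B_n & D_n\end{bmatrix}$. Let $a_n, b_n$ be the waves incident on, respectively leaving, element $n$ at its outer port, and let $a_{n0}, b_{n0}$ be the waves incident on, respectively leaving, element $n$ at its inner port, so that $$\begin{bmatrix} b_n \\ b_{n0}\end{bmatrix} = \mathbf{S}_n \begin{bmatrix} a_n \\ a_{n0}\end{bmatrix},\qquad n=1,2.$$ The gyrator receives $b_{10}, b_{20}$ at its ports 1, 2 and emits $a_{10}, a_{20}$: $[a_{10},a_{20}]^{\mathrm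 T} = \mathbf{S}_{\mathrm{gyra}}\,[b_{10},b_{20}]^{\mathrm T}$, i.e. $a_{10}=-b_{20}$ and $a_{20}=b_{10}$. The scattering matrix $\mathbf{\Phi}$ of the group is the $2\times 2$ matrix relating the outer waves when these relations hold: $[b_1,b_2]^{\mathrm T} = \mathbf{\Phi}\,[a_1,a_2]^{\mathrm T}$. A matrix is non-symmetric if it differs from its transpose.
   Formalization: Non-symmetry of Φ is claimed only when B_1 and B_2 are both nonzero, since otherwise Φ is diagonal and hence symmetric (e.g. Z_1 = Z_2 = Z_0 I); Δ ≠ 0 is assumed so that the formula is defined. *)

theory Defs
  imports "HOL-Analysis.Analysis"
begin

text \<open>The scattering matrix with respect to the real reference impedance \<open>Z0\<close>. Index 1 is the
  outer port and index 2 the inner port. It is meaningful only if \<open>Z + Z0 I\<close> is invertible.\<close>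

definition scattering_matrix :: "real \<Rightarrow> complex^2^2 \<Rightarrow> complex^2^2" where
  "scattering_matrix Z0 Z =
     (Z - mat (complex_of_real Z0)) ** matrix_inv (Z + mat (complex_of_real Z0))"

definition gyrator :: "complex^2^2" where
  "gyrator = vector [vector [0, -1], vector [1, 0]]"

text \<open>Here \<open>a\<close> and \<open>b\<close> collect the waves incident on, respectively leaving, the two elements at
  their outer ports, and \<open>a0\<close> and \<open>b0\<close> those at their inner ports; the index is the number of the
  element. The waves leaving the elements at the inner ports are incident on the gyrator.\<close>

definition group_waves ::
    "complex^2^2 \<Rightarrow> complex^2^2 \<Rightarrow> complex^2 \<Rightarrow> complex^2 \<Rightarrow> complex^2 \<Rightarrow> complex^2 \<Rightarrow> bool" where
  "group_waves S1 S2 a b a0 b0 \<longleftrightarrow>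
     (vector [b$1, b0$1] :: complex^2) = S1 *v vector [a$1, a0$1] \<and>
     (vector [b$2, b0$2] :: complex^2) = S2 *v vector [a$2, a0$2] \<and>
     a0 = gyrator *v b0"

text \<open>The equivalence also demands that every pair of incident outer waves can occur, so that at
  most one matrix is a scattering matrix of the group.\<close>

definition is_group_scattering_matrix ::
    "complex^2^2 \<Rightarrow> complex^2^2 \<Rightarrow> complex^2^2 \<Rightarrow> bool" where
  "is_group_scattering_matrix S1 S2 \<Phi> \<longleftrightarrow>
     (\<forall>a b. (\<exists>a0 b0. group_waves S1 S2 a b a0 b0) \<longleftrightarrow> b = \<Phi> *v a)"

end

theory Submission
  imports Defs
begin

text \<open>With \<open>c = Z0\<close>, one has \<open>(Z - c I) (Z + c I)\<^sup>-\<^sup>1 = I - 2 c (Z + c I)\<^sup>-\<^sup>1\<close>,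
  which is symmetric when \<open>Z\<close> is. The gyrator relations turn the inner equations into a linear
  system for the waves that leave the elements at their inner ports; its determinant is \<open>\<Delta>\<close>, and
  substituting its solution into the outer equations gives the entries of the group matrix.\<close>

lemma matrix_add_rdistrib:
  fixes A B :: "'a::semiring_1^'n^'m" and C :: "'a^'p^'n"
  shows "(A + B) ** C = A ** C + B ** C"
  by (simp add: vec_eq_iff matrix_matrix_mult_def distrib_right sum.distrib)

text \<open>\<open>matrix_inv\<close> is a Hilbert choice, so its equations rest on the witness that
  invertibility supplies.\<close>

lemma matrix_inv:
  fixes A :: "'a::semiring_1^'n^'m"
  assumes "invertible A"
  shows matrix_inv_right: "A ** matrix_inv A = mat 1"
    and matrix_inv_left: "matrix_inv A ** A = mat 1"
proof -
  have "A ** matrix_inv A = mat 1 \<and> matrix_inv A ** A = mat 1"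
    using assms unfolding invertible_def matrix_inv_def by (rule someI_ex)
  then show "A ** matrix_inv A = mat 1" "matrix_inv A ** A = mat 1"
    by simp_all
qed

text \<open>By symmetry of \<open>A\<close>, transposing \<open>A ** matrix_inv A = mat 1\<close>
  makes the transposed inverse a left inverse of \<open>A\<close>; by associativity a left inverse
  agrees with a right inverse.\<close>

lemma transpose_matrix_inv_symmetric:
  fixes A :: "'a::comm_semiring_1^'n^'n"
  assumes "invertible A" and "transpose A = A"
  shows "transpose (matrix_inv A) = matrix_inv A"
proof -
  have "transpose (matrix_inv A) ** A = transpose (A ** matrix_inv A)"
    using assms(2) by (simp add: matrix_transpose_mul)
  also have "\<dots> = mat 1"
    using assms(1) by (simp add: matrix_inv_right)
  finally have "transpose (matrix_inv A) ** A ** matrix_inv A = matrix_inv A"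
    by simp
  then show ?thesis
    using assms(1) by (simp add: matrix_inv_right flip: matrix_mul_assoc)
qed

text \<open>Only one factor here is not scalar, so transposing does not require commuting
  \<open>Z - mat (complex_of_real Z0)\<close> with the inverse.\<close>

lemma scattering_matrix_eq:
  assumes "invertible (Z + mat (complex_of_real Z0))"
  shows "scattering_matrix Z0 Z =
    mat 1 - mat (2 * complex_of_real Z0) ** matrix_inv (Z + mat (complex_of_real Z0))"
proof -
  let ?W = "matrix_inv (Z + mat (complex_of_real Z0))"
  have eq: "Z + mat (complex_of_real Z0) =
      (Z - mat (complex_of_real Z0)) + mat (2 * complex_of_real Z0)"
    by (simp add: vec_eq_iff mat_def)
  have "mat 1 = ((Z - mat (complex_of_real Z0)) + mat (2 * complex_of_real Z0)) ** ?W"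
    by (simp only: matrix_inv_right[OF assms] flip: eq)
  then show ?thesis
    by (simp add: scattering_matrix_def matrix_add_rdistrib)
qed

lemma transpose_scattering_matrix:
  assumes "transpose Z = Z" and inv: "invertible (Z + mat (complex_of_real Z0))"
  shows "transpose (scattering_matrix Z0 Z) = scattering_matrix Z0 Z"
proof -
  let ?W = "matrix_inv (Z + mat (complex_of_real Z0))"
  have "transpose (Z + mat (complex_of_real Z0)) =
      transpose Z + transpose (mat (complex_of_real Z0))"
    by (simp add: vec_eq_iff transpose_def)
  then have W: "transpose ?W = ?W"
    using transpose_matrix_inv_symmetric[OF inv] assms(1) by simp
  \<comment> \<open>At size 2 symmetry is one equation between the off-diagonal entries, and a
    scalar matrix only rescales the entries of \<open>X\<close>.\<close>
  have "transpose (mat 1 - mat k ** X) = mat 1 - mat k ** X"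
    if "transpose X = X" for k and X :: "complex^2^2"
  proof -
    have "X$2$1 = X$1$2"
      by (subst that[symmetric]) (simp add: transpose_def)
    then show ?thesis
      by (simp add: vec_eq_iff transpose_def forall_2 matrix_matrix_mult_def sum_2 mat_def)
  qed
  from this[OF W] show ?thesis
    unfolding scattering_matrix_eq[OF inv] .
qed

lemma symmetric_matrix_2_eq:
  fixes S :: "'a::zero^2^2"
  assumes "transpose S = S"
  shows "S = vector [vector [S$1$1, S$1$2], vector [S$1$2, S$2$2]]"
proof -
  have "S$2$1 = S$1$2"
    by (subst assms[symmetric]) (simp add: transpose_def)
  then show ?thesis
    by (simp add: vec_eq_iff forall_2)
qed

text \<open>The inner equations are bracketed in front so that they match the system solved in
  \<open>gyrator_inner_waves\<close> and can be rewritten as a block.\<close>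

lemma group_waves_iff:
  "group_waves (vector [vector [A1, B1], vector [B1, D1]])
     (vector [vector [A2, B2], vector [B2, D2]]) a b a0 b0 \<longleftrightarrow>
   (b0$1 = B1 * a$1 - D1 * b0$2 \<and> b0$2 = B2 * a$2 + D2 * b0$1) \<and>
   b$1 = A1 * a$1 - B1 * b0$2 \<and> b$2 = A2 * a$2 + B2 * b0$1 \<and>
   a0$1 = - b0$2 \<and> a0$2 = b0$1"
proof -
  have gyrator: "a0 = gyrator *v b0 \<longleftrightarrow> a0$1 = - b0$2 \<and> a0$2 = b0$1"
    by (simp add: gyrator_def vec_eq_iff forall_2 matrix_vector_mult_def sum_2)
  show ?thesis
  \<comment> \<open>If the gyrator relations hold, they eliminate \<open>a0\<close>; otherwise both
    sides are false.\<close>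
  proof (cases "a0$1 = - b0$2 \<and> a0$2 = b0$1")
    case True
    then show ?thesis
      unfolding group_waves_def gyrator
      by (simp add: vec_eq_iff forall_2 matrix_vector_mult_def sum_2 conj_ac)
  next
    case False
    then show ?thesis
      unfolding group_waves_def gyrator by blast
  qed
qed

text \<open>Cramer's rule for the coefficient matrix with rows \<open>(1, D1)\<close> and
  \<open>(-D2, 1)\<close>.\<close>

lemma gyrator_inner_waves:
  fixes B1 D1 B2 D2 x1 x2 y1 y2 :: "'a::field"
  assumes "1 + D1 * D2 \<noteq> 0"
  shows "y1 = B1 * x1 - D1 * y2 \<and> y2 = B2 * x2 + D2 * y1 \<longleftrightarrow>
    y1 = (B1 * x1 - D1 * B2 * x2) / (1 + D1 * D2) \<and>
    y2 = (B2 * x2 + D2 * B1 * x1) / (1 + D1 * D2)"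
    (is "?sys \<longleftrightarrow> ?sol")
proof
  assume ?sys
  then have "y1 * (1 + D1 * D2) = B1 * x1 - D1 * B2 * x2"
    and "y2 * (1 + D1 * D2) = B2 * x2 + D2 * B1 * x1"
    by algebra+
  then show ?sol
    using assms by (simp add: eq_divide_eq)
next
  assume ?sol
  then have "y1 * (1 + D1 * D2) = B1 * x1 - D1 * B2 * x2"
    and "y2 * (1 + D1 * D2) = B2 * x2 + D2 * B1 * x1"
    using assms by simp_all
  \<comment> \<open>Scaling by the determinant leaves division-free goals for
    \<open>algebra\<close>; since it is nonzero, it cancels afterwards.\<close>
  then have "(1 + D1 * D2) * y1 = (1 + D1 * D2) * (B1 * x1 - D1 * y2)"
    and "(1 + D1 * D2) * y2 = (1 + D1 * D2) * (B2 * x2 + D2 * y1)"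
    by algebra+
  then show ?sys
    using assms mult_left_cancel[of "1 + D1 * D2"] by blast
qed

text \<open>For every \<open>a\<close> exactly one choice of inner waves meets the inner equations,
  so the existential collapses to the two outer equations.\<close>

lemma is_group_scattering_matrix_gyrator:
  assumes "\<Delta> = 1 + D1 * D2" and "\<Delta> \<noteq> 0"
  shows "is_group_scattering_matrix (vector [vector [A1, B1], vector [B1, D1]])
      (vector [vector [A2, B2], vector [B2, D2]])
      (vector [vector [A1 - B1^2 * D2 / \<Delta>, - (B1 * B2) / \<Delta>],
               vector [B1 * B2 / \<Delta>, A2 - B2^2 * D1 / \<Delta>]])"
    (is "is_group_scattering_matrix ?S1 ?S2 ?\<Phi>")
  unfolding is_group_scattering_matrix_def
proof (intro allI)
  fix a b :: "complex^2"
  define y1 where "y1 = (B1 * a$1 - D1 * B2 * a$2) / \<Delta>"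
  define y2 where "y2 = (B2 * a$2 + D2 * B1 * a$1) / \<Delta>"
  note inner = gyrator_inner_waves[of D1 D2, folded assms(1), OF assms(2)]
  have "group_waves ?S1 ?S2 a b a0 b0 \<longleftrightarrow>
      b0$1 = y1 \<and> b0$2 = y2 \<and> a0$1 = - y2 \<and> a0$2 = y1 \<and>
      b$1 = A1 * a$1 - B1 * y2 \<and> b$2 = A2 * a$2 + B2 * y1" for a0 b0
    unfolding group_waves_iff inner y1_def[symmetric] y2_def[symmetric] by auto
  moreover have "\<exists>(a0 :: complex^2) (b0 :: complex^2).
      b0$1 = y1 \<and> b0$2 = y2 \<and> a0$1 = - y2 \<and> a0$2 = y1"
    \<comment> \<open>The witness for \<open>a0\<close> is the gyrator's image of the witness for
      \<open>b0\<close>.\<close>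
    by (rule exI[of _ "vector [- y2, y1]"], rule exI[of _ "vector [y1, y2]"]) simp
  ultimately have "(\<exists>a0 b0. group_waves ?S1 ?S2 a b a0 b0) \<longleftrightarrow>
      b$1 = A1 * a$1 - B1 * y2 \<and> b$2 = A2 * a$2 + B2 * y1"
    by auto
  also have "\<dots> \<longleftrightarrow> b = ?\<Phi> *v a"
  proof -
    \<comment> \<open>Coefficients of \<open>a$1\<close> and \<open>a$2\<close> are collected; the
      wave returning to its own element gives the diagonal corrections.\<close>
    have "A1 * a$1 - B1 * y2 = (A1 - B1^2 * D2 / \<Delta>) * a$1 + - (B1 * B2) / \<Delta> * a$2"
      "A2 * a$2 + B2 * y1 = B1 * B2 / \<Delta> * a$1 + (A2 - B2^2 * D1 / \<Delta>) * a$2"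
      using assms(2) by (simp_all add: y1_def y2_def field_simps power2_eq_square)
    then show ?thesis
      by (simp add: vec_eq_iff forall_2 matrix_vector_mult_def sum_2)
  qed
  finally show "(\<exists>a0 b0. group_waves ?S1 ?S2 a b a0 b0) \<longleftrightarrow> b = ?\<Phi> *v a" .
qed

text \<open>For any \<open>a\<close>, taking \<open>b = \<Phi> *v a\<close> makes inner waves exist,
  which forces \<open>b = \<Psi> *v a\<close>.\<close>

lemma is_group_scattering_matrix_unique:
  assumes "is_group_scattering_matrix S1 S2 \<Phi>" and "is_group_scattering_matrix S1 S2 \<Psi>"
  shows "\<Phi> = \<Psi>"
  using assms unfolding is_group_scattering_matrix_def matrix_eq by metis

theorem theorem2:
  fixes Z0 :: real
    and Z1 Z2 S1 S2 :: "complex^2^2"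
    and A1 B1 D1 A2 B2 D2 \<Delta> :: complex
  assumes "Z0 > 0"
    and "transpose Z1 = Z1" and "transpose Z2 = Z2"
    and "invertible (Z1 + mat (complex_of_real Z0))"
    and "invertible (Z2 + mat (complex_of_real Z0))"
    and "S1 = scattering_matrix Z0 Z1" and "S2 = scattering_matrix Z0 Z2"
    and "A1 = S1$1$1" and "B1 = S1$1$2" and "D1 = S1$2$2"
    and "A2 = S2$1$1" and "B2 = S2$1$2" and "D2 = S2$2$2"
    and "\<Delta> = 1 + D1 * D2" and "\<Delta> \<noteq> 0"
  shows "S1 = vector [vector [A1, B1], vector [B1, D1]] \<and>
    S2 = vector [vector [A2, B2], vector [B2, D2]] \<and>
    (\<exists>!\<Phi>. is_group_scattering_matrix S1 S2 \<Phi>) \<and>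
    (\<forall>\<Phi>. is_group_scattering_matrix S1 S2 \<Phi> \<longrightarrow>
       \<Phi> = vector [vector [A1 - B1^2 * D2 / \<Delta>, - (B1 * B2) / \<Delta>],
                   vector [B1 * B2 / \<Delta>, A2 - B2^2 * D1 / \<Delta>]] \<and>
       (B1 \<noteq> 0 \<and> B2 \<noteq> 0 \<longrightarrow> transpose \<Phi> \<noteq> \<Phi>))"
proof -
  let ?\<Phi> = "vector [vector [A1 - B1^2 * D2 / \<Delta>, - (B1 * B2) / \<Delta>],
    vector [B1 * B2 / \<Delta>, A2 - B2^2 * D1 / \<Delta>]] :: complex^2^2"
  have S1: "S1 = vector [vector [A1, B1], vector [B1, D1]]"
    unfolding assms(8-10)
    by (rule symmetric_matrix_2_eq) (simp add: assms(2,4,6) transpose_scattering_matrix)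
  have S2: "S2 = vector [vector [A2, B2], vector [B2, D2]]"
    unfolding assms(11-13)
    by (rule symmetric_matrix_2_eq) (simp add: assms(3,5,7) transpose_scattering_matrix)
  have \<Phi>: "is_group_scattering_matrix S1 S2 ?\<Phi>"
    unfolding S1 S2 by (rule is_group_scattering_matrix_gyrator) fact+
  \<comment> \<open>The off-diagonal entries are negatives of each other, so symmetry would force
    \<open>B1 * B2 = 0\<close>.\<close>
  have "transpose ?\<Phi> \<noteq> ?\<Phi>" if "B1 \<noteq> 0" "B2 \<noteq> 0"
  proof
    assume "transpose ?\<Phi> = ?\<Phi>"
    then have "transpose ?\<Phi> $ 1 $ 2 = ?\<Phi> $ 1 $ 2"
      by simp
    then show False
      using that \<open>\<Delta> \<noteq> 0\<close> by (simp add: transpose_def)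
  qed
  then show ?thesis
    using S1 S2 \<Phi> is_group_scattering_matrix_unique by blast
qed

end
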